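(* For all integers $n\ge 1$ and $0\le l<n$, the bivariate Laurent polynomial $$a_n^l(z_1,z_2)=\sum_{i=0}^{l}\tilde a_{n-i}(z_1,z_2)\,b_n^i(z_1,z_2)$$ (with $\tilde a_m$ and $b_n^i$ as defined in the context) is symmetric, generates polynomials up to degree $2n-1$, and reproduces polynomials up to degree $2l+1$. Moreover, for every $n\ge1$ the symbol $a_n^{n-1}$ (the case $l=n-1$) is interpolatory.
   Context: A symbol is a bivariate Laurent polynomial $a(z_1,z_2)=\sum_{\alpha\in\mathbb Z^2}a_\alpha z_1^{\alpha_1}z_2^{\alpha_2}$ with finitely many nonzero real coefficients $a_\alpha$, regarded as a function of $(z_1,z_2)\in(\mathbb C\setminus\{0\})^2$. For $k=(k_1,k_2)\in\mathbb N_0^2$, $D^k=\partial_{z_1}^{k_1}\partial_{z_2}^{k_2}$ and $|k|=k_1+k_2$. Let $E'=\{(-1,1),(1,-1),(-1,-1)\}$. Symmetric: $a(z_1,z_2)=a(1/z_1,z_2)=a(z_1,1/z_2)=a(z_2,z_1)$. Generates polynomials up to degree $m$: $(D^k a)(z)=0$ for all $z\in E'$ and all $k\in\mathbb N_0^2$ with $0\le|k|\le m$. Reproduces polynomials up to degree $m'$ (for a symbol that generates polynomials up to some degree $m\ge m'$): $a(1,1)=4$ and $(D^k a)(1,1)=0$ for all $k\in\mathbb N_0^2$ with $0<|k|\le m'$. Interpolatory: $a(z_1,z_2)+a(z_1,-z_2)+a(-z_1,z_2)+a(-z_1,-z_2)=4$ (equivalently $a_{(0,0)}=1$ and $a_{2\alpha}=0$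 for $\alpha\in\mathbb Z^2\setminus\{(0,0)\}$). Definition of the family. Let $$\sigma(z)=\frac{(1+z)^2}{4z},\qquad \delta(z)=-\frac{(1-z)^2}{4z},$$ $$S(z_1,z_2)=\sigma(z_1)\sigma(z_2),\qquad G(z_1,z_2)=\sigma(z_1)\sigma(z_2)-\delta(z_1)\delta(z_2).$$ For $m\ge1$ let $\tilde a_m=4\,S^{\lceil m/2\rceil}G^{\lfloor m/2\rfloor}$. For $0\le j\le i<n$ let $$c_n^{(i,j)}=\sum_{k=0}^{\lfloor i/2\rfloor}\binom{\lfloor\frac{n-i}{2}\rfloor+k-1}{k}\binom{n+i-2j-1}{i-j-k}\binom{n+2j-i-1}{j-k},$$ where a binomial coefficient $\binom{p}{q}$ is $0$ if $q<0$, $\binom{p}{0}=1$ for every integer $p\ge-1$ (in particular $\binom{-1}{0}=1$), and $\binom{p}{q}=0$ if $0\le p<q$. Finally $$b_n^i(z_1,z_2)=\sum_{j=0}^{i}c_n^{(i,j)}\bigl(\sigma(z_1)\delta(z_1)\bigr)^{i-j}\bigl(\sigma(z_2)\delta(z_2)\bigr)^{j}.$$ *)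

theory Defs
  imports "HOL-Analysis.Analysis"
begin

text \<open>
  Symbols are functions of two complex variables. Only their values at nonzero arguments
  matter: every identity below is restricted to nonzero arguments, and derivatives are
  taken only at points whose coordinates are $1$ or $-1$.
\<close>

definition laurent_symbol :: "(complex \<Rightarrow> complex \<Rightarrow> complex) \<Rightarrow> bool" where
  "laurent_symbol a \<longleftrightarrow>
     (\<exists>c :: int \<times> int \<Rightarrow> real. finite {\<alpha>. c \<alpha> \<noteq> 0} \<and>
        (\<forall>z1 z2. z1 \<noteq> 0 \<longrightarrow> z2 \<noteq> 0 \<longrightarrow>
           a z1 z2 = (\<Sum>\<alpha> | c \<alpha> \<noteq> 0. of_real (c \<alpha>) * z1 powi (fst \<alpha>) * z2 powi (snd \<alpha>))))"

definition partial_D ::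
  "nat \<Rightarrow> nat \<Rightarrow> (complex \<Rightarrow> complex \<Rightarrow> complex) \<Rightarrow> complex \<Rightarrow> complex \<Rightarrow> complex" where
  "partial_D k1 k2 a z1 z2 = (deriv ^^ k1) (\<lambda>w1. (deriv ^^ k2) (\<lambda>w2. a w1 w2) z2) z1"

definition symbol_symmetric :: "(complex \<Rightarrow> complex \<Rightarrow> complex) \<Rightarrow> bool" where
  "symbol_symmetric a \<longleftrightarrow>
     (\<forall>z1 z2. z1 \<noteq> 0 \<longrightarrow> z2 \<noteq> 0 \<longrightarrow>
        a z1 z2 = a (1 / z1) z2 \<and> a z1 z2 = a z1 (1 / z2) \<and> a z1 z2 = a z2 z1)"

definition generates_polys :: "(complex \<Rightarrow> complex \<Rightarrow> complex) \<Rightarrow> nat \<Rightarrow> bool" where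
  "generates_polys a m \<longleftrightarrow>
     (\<forall>(z1, z2) \<in> {(-1, 1), (1, -1), (-1, -1)}.
        \<forall>k1 k2. k1 + k2 \<le> m \<longrightarrow> partial_D k1 k2 a z1 z2 = 0)"

definition reproduces_polys :: "(complex \<Rightarrow> complex \<Rightarrow> complex) \<Rightarrow> nat \<Rightarrow> bool" where
  "reproduces_polys a m' \<longleftrightarrow>
     (\<exists>m \<ge> m'. generates_polys a m) \<and> a 1 1 = 4 \<and>
     (\<forall>k1 k2. 0 < k1 + k2 \<and> k1 + k2 \<le> m' \<longrightarrow> partial_D k1 k2 a 1 1 = 0)"

definition interpolatory :: "(complex \<Rightarrow> complex \<Rightarrow> complex) \<Rightarrow> bool" where
  "interpolatory a \<longleftrightarrow>
     (\<forall>z1 z2. z1 \<noteq> 0 \<longrightarrow> z2 \<noteq> 0 \<longrightarrow>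
        a z1 z2 + a z1 (- z2) + a (- z1) z2 + a (- z1) (- z2) = 4)"

definition sigma_fun :: "complex \<Rightarrow> complex" where
  "sigma_fun z = (1 + z)\<^sup>2 / (4 * z)"

definition delta_fun :: "complex \<Rightarrow> complex" where
  "delta_fun z = - ((1 - z)\<^sup>2 / (4 * z))"

definition S_fun :: "complex \<Rightarrow> complex \<Rightarrow> complex" where
  "S_fun z1 z2 = sigma_fun z1 * sigma_fun z2"

definition G_fun :: "complex \<Rightarrow> complex \<Rightarrow> complex" where
  "G_fun z1 z2 = sigma_fun z1 * sigma_fun z2 - delta_fun z1 * delta_fun z2"

definition a_tilde :: "nat \<Rightarrow> complex \<Rightarrow> complex \<Rightarrow> complex" where
  "a_tilde m z1 z2 =
     4 * S_fun z1 z2 ^ nat \<lceil>real m / 2\<rceil> * G_fun z1 z2 ^ nat \<lfloor>real m / 2\<rfloor>"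

text \<open>
  In \<open>coeff_c\<close> with \<open>j \<le> i < n\<close> the upper argument is never below $-1$,
  and it equals $-1$ only when the lower argument is $0$, where the value is $1$.
\<close>

definition int_binom :: "int \<Rightarrow> int \<Rightarrow> real" where
  "int_binom p q = (if q < 0 then 0 else real_of_int p gchoose nat q)"

definition coeff_c :: "nat \<Rightarrow> nat \<Rightarrow> nat \<Rightarrow> real" where
  "coeff_c n i j =
     (\<Sum>k = 0..i div 2.
        int_binom ((int n - int i) div 2 + int k - 1) (int k) *
        int_binom (int n + int i - 2 * int j - 1) (int i - int j - int k) *
        int_binom (int n + 2 * int j - int i - 1) (int j - int k))"

definition b_fun :: "nat \<Rightarrow> nat \<Rightarrow> complex \<Rightarrow> complex \<Rightarrow> complex" where
  "b_fun n i z1 z2 =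
     (\<Sum>j = 0..i. of_real (coeff_c n i j) *
        (sigma_fun z1 * delta_fun z1) ^ (i - j) * (sigma_fun z2 * delta_fun z2) ^ j)"

definition a_family :: "nat \<Rightarrow> nat \<Rightarrow> complex \<Rightarrow> complex \<Rightarrow> complex" where
  "a_family n l z1 z2 = (\<Sum>i = 0..l. a_tilde (n - i) z1 z2 * b_fun n i z1 z2)"

end

theory Submission
  imports Defs "HOL-Complex_Analysis.Complex_Analysis"
begin

text \<open>
  Write $x = \sigma(z_1)$, $p = \delta(z_1) = 1 - x$, $y = \sigma(z_2)$, $q = \delta(z_2) = 1 - y$
  and $m = n - 1$. Since $G + pq = S$, the binomial theorem collapses the inner sums of the case
  $l = m$: the symbol $a_n^{n-1} / 4$ is the sum over $a + b \le m$ of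
  $\binom{m+a-b}{a} \binom{m+b-a}{b} p^a x^{m-b} q^b y^{m-a}$, weighted by $xy - pq$ if $a + b < m$
  and by $xy$ if $a + b = m$.

  These terms are probabilities. Let $X_A$ be a simple random walk after $A$ steps with up-probability
  $p$, and $Y_B$ an independent one after $B$ steps with up-probability $q$. The term $(a, b)$ belongs
  to the event $X_A = Y_{2m-A} = a + b - m$ with $A = m + a - b$. The probability that
  $|X_A| > |Y_{2m+1-A}|$ rises from $0$ at $A = 0$ to $1$ at $A = 2m + 1$, and its increments only
  come from the event $|X_A| = |Y_{2m-A}|$. Summing the increments gives exactly the sum of the
  four sign changes of the symbol, because $z \mapsto -z$ exchanges $\sigma$ and $\delta$. Hence the
  symbol is interpolatory.

  Generation follows by counting orders of vanishing factor by factor. At $(1, 1)$, interpolation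
  writes $a_n^{n-1} - 4$ through values of the symbol near the other three corners, where it vanishes
  to order $2n$; the terms with $i > l$ vanish to order $2l + 2$, which gives reproduction for all $l$.
\<close>

section \<open>Crossings of two random walks\<close>

fun walk_mean :: "'a::comm_semiring_1 \<Rightarrow> 'a \<Rightarrow> nat \<Rightarrow> (int \<Rightarrow> 'a) \<Rightarrow> 'a" where
  "walk_mean p x 0 f = f 0"
| "walk_mean p x (Suc A) f =
     p * walk_mean p x A (\<lambda>X. f (X + 1)) + x * walk_mean p x A (\<lambda>X. f (X - 1))"

lemma walk_mean_add:
  "walk_mean p x A (\<lambda>X. f X + g X) = walk_mean p x A f + walk_mean p x A g"
  by (induction A arbitrary: f g) (simp_all add: algebra_simps)

lemma walk_mean_diff:
  fixes p :: "'a::comm_ring_1"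
  shows "walk_mean p x A (\<lambda>X. f X - g X) = walk_mean p x A f - walk_mean p x A g"
  by (induction A arbitrary: f g) (simp_all add: right_diff_distrib add_diff_add)

lemma walk_mean_mult_left:
  "walk_mean p x A (\<lambda>X. k * f X) = k * walk_mean p x A f"
  by (induction A arbitrary: f) (simp_all add: algebra_simps)

lemma walk_mean_const:
  assumes "p + x = 1"
  shows "walk_mean p x A (\<lambda>_. k) = k"
  using assms by (induction A) (simp_all flip: distrib_right)

lemma walk_mean_cong_parity:
  assumes "\<And>X. even (X + int A) \<Longrightarrow> f X = g X"
  shows "walk_mean p x A f = walk_mean p x A g"
  using assms
proof (induction A arbitrary: f g)
  case (Suc A)
  have "walk_mean p x A (\<lambda>X. f (X + 1)) = walk_mean p x A (\<lambda>X. g (X + 1))"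
    "walk_mean p x A (\<lambda>X. f (X - 1)) = walk_mean p x A (\<lambda>X. g (X - 1))"
    by (intro Suc; simp)+
  then show ?case by simp
qed simp

lemma walk_mean_reflect: "walk_mean p x A (\<lambda>X. f (- X)) = walk_mean x p A f"
proof (induction A arbitrary: f)
  case (Suc A)
  show ?case
    using Suc[of "\<lambda>X. f (X - 1)"] Suc[of "\<lambda>X. f (X + 1)"] by (simp add: add.commute)
qed simp

lemma walk_mean_Suc_last_step:
  "walk_mean p x (Suc A) f = walk_mean p x A (\<lambda>X. p * f (X + 1) + x * f (X - 1))"
  by (simp add: walk_mean_add walk_mean_mult_left)

lemma sum_choose_Suc:
  fixes g :: "nat \<Rightarrow> 'a::comm_semiring_1"
  shows "(\<Sum>k\<le>Suc n. of_nat (Suc n choose k) * g k) =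
    (\<Sum>k\<le>n. of_nat (n choose k) * (g k + g (Suc k)))"
proof -
  have "(\<Sum>k\<le>Suc n. of_nat (Suc n choose k) * g k) =
      (g 0 + (\<Sum>k\<le>n. of_nat (n choose Suc k) * g (Suc k))) + (\<Sum>k\<le>n. of_nat (n choose k) * g (Suc k))"
    by (subst sum.atMost_Suc_shift) (simp add: sum.distrib algebra_simps)
  also have "g 0 + (\<Sum>k\<le>n. of_nat (n choose Suc k) * g (Suc k)) = (\<Sum>k\<le>Suc n. of_nat (n choose k) * g k)"
    by (subst sum.atMost_Suc_shift) simp
  also have "\<dots> = (\<Sum>k\<le>n. of_nat (n choose k) * g k)"
    by (simp add: binomial_eq_0)
  finally show ?thesis by (simp add: sum.distrib distrib_left)
qed

lemma walk_mean_eq_binomial_sum: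
  "walk_mean p x A f =
     (\<Sum>\<alpha>\<le>A. of_nat (A choose \<alpha>) * (p ^ \<alpha> * x ^ (A - \<alpha>) * f (2 * int \<alpha> - int A)))"
proof (induction A arbitrary: f)
  case (Suc A)
  show ?case
    unfolding sum_choose_Suc walk_mean.simps Suc sum_distrib_left sum.distrib[symmetric]
    by (rule sum.cong) (auto simp: Suc_diff_le algebra_simps)
qed simp

definition split_walk_mean ::
  "'a::comm_semiring_1 \<Rightarrow> 'a \<Rightarrow> 'a \<Rightarrow> 'a \<Rightarrow> nat \<Rightarrow> (int \<Rightarrow> int \<Rightarrow> 'a) \<Rightarrow> 'a" where
  "split_walk_mean p x q y N f =
     (\<Sum>A\<le>N. walk_mean p x A (\<lambda>X. walk_mean q y (N - A) (f X)))"

lemma split_walk_mean_add: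
  "split_walk_mean p x q y N (\<lambda>X Y. f X Y + g X Y) =
     split_walk_mean p x q y N f + split_walk_mean p x q y N g"
  by (simp add: split_walk_mean_def walk_mean_add sum.distrib)

lemma split_walk_mean_cong_parity:
  assumes "\<And>X Y. even (X + Y + int N) \<Longrightarrow> f X Y = g X Y"
  shows "split_walk_mean p x q y N f = split_walk_mean p x q y N g"
  unfolding split_walk_mean_def
  by (intro sum.cong refl walk_mean_cong_parity assms) (auto simp: of_nat_diff)

lemma split_walk_mean_reflect_fst:
  "split_walk_mean p x q y N (\<lambda>X. f (- X)) = split_walk_mean x p q y N f"
  unfolding split_walk_mean_def
  by (intro sum.cong refl walk_mean_reflect[where f = "\<lambda>X. walk_mean q y _ (f X)"])

lemma split_walk_mean_reflect_snd:
  "split_walk_mean p x q y N (\<lambda>X Y. f X (- Y)) = split_walk_mean p x y q N f"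
  by (simp add: split_walk_mean_def walk_mean_reflect)

definition step_exchange ::
  "'a::comm_ring_1 \<Rightarrow> 'a \<Rightarrow> 'a \<Rightarrow> 'a \<Rightarrow> (int \<Rightarrow> int \<Rightarrow> 'a) \<Rightarrow> int \<Rightarrow> int \<Rightarrow> 'a" where
  "step_exchange p x q y \<phi> X Y =
     (p * \<phi> (X + 1) Y + x * \<phi> (X - 1) Y) - (q * \<phi> X (Y + 1) + y * \<phi> X (Y - 1))"

lemma split_walk_mean_step_exchange:
  fixes \<phi> :: "int \<Rightarrow> int \<Rightarrow> 'a::comm_ring_1"
  shows "split_walk_mean p x q y N (step_exchange p x q y \<phi>) =
    walk_mean p x (Suc N) (\<lambda>X. \<phi> X 0) - walk_mean q y (Suc N) (\<phi> 0)"
proof -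
  define \<Phi> where "\<Phi> A = walk_mean p x A (\<lambda>X. walk_mean q y (Suc N - A) (\<phi> X))" for A
  have "walk_mean p x A (\<lambda>X. walk_mean q y (N - A) (step_exchange p x q y \<phi> X)) = \<Phi> (Suc A) - \<Phi> A"
    if "A \<le> N" for A
  proof -
    have "\<Phi> A = walk_mean p x A (\<lambda>X. walk_mean q y (N - A) (\<lambda>Y. q * \<phi> X (Y + 1) + y * \<phi> X (Y - 1)))"
      using that by (simp add: \<Phi>_def Suc_diff_le walk_mean_Suc_last_step del: walk_mean.simps)
    moreover have "\<Phi> (Suc A) =
        walk_mean p x A (\<lambda>X. walk_mean q y (N - A) (\<lambda>Y. p * \<phi> (X + 1) Y + x * \<phi> (X - 1) Y))"
      by (simp add: \<Phi>_def walk_mean_add walk_mean_mult_left)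
    ultimately show ?thesis by (simp add: step_exchange_def[abs_def] walk_mean_diff)
  qed
  then have "split_walk_mean p x q y N (step_exchange p x q y \<phi>) = (\<Sum>A<Suc N. \<Phi> (Suc A) - \<Phi> A)"
    by (simp add: split_walk_mean_def lessThan_Suc_atMost)
  also have "\<dots> = \<Phi> (Suc N) - \<Phi> 0" by (rule sum_lessThan_telescope)
  finally show ?thesis by (simp add: \<Phi>_def del: walk_mean.simps(2))
qed

text \<open>
  The part of the crossing weight seen by one of the four sign changes of the symbol. At the origin,
  where both walks meet all four diagonal rays, the total weight $1 = (p + x)(q + y)$ is shared out.
\<close>

definition diag_weight :: "'a::zero \<Rightarrow> 'a \<Rightarrow> int \<Rightarrow> int \<Rightarrow> 'a" where
  "diag_weight w\<^sub>0 w X Y = (if X = Y \<and> X < 0 then w else if X = 0 \<and> Y = 0 then w\<^sub>0 else 0)"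

definition diag_kernel :: "nat \<Rightarrow> 'a::comm_ring_1 \<Rightarrow> 'a \<Rightarrow> 'a \<Rightarrow> 'a \<Rightarrow> 'a" where
  "diag_kernel m p x q y =
     (\<Sum>(a, b) | a + b \<le> m. of_nat ((m + a - b) choose a) * of_nat ((m + b - a) choose b) *
        (p ^ a * x ^ (m - b)) * (q ^ b * y ^ (m - a)) *
        (if a + b = m then x * y else x * y - p * q))"

lemma diag_weight_walk_positions:
  assumes "\<alpha> \<le> A" "\<beta> \<le> B" "A + B = 2 * m"
  shows "diag_weight w\<^sub>0 w (2 * int \<alpha> - int A) (2 * int \<beta> - int B) =
    (if A + \<beta> = \<alpha> + m \<and> \<alpha> + \<beta> \<le> m then if \<alpha> + \<beta> = m then w\<^sub>0 else w else 0)"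
proof -
  have "int B = 2 * int m - int A" using assms(3) by linarith
  then show ?thesis by (auto simp: diag_weight_def)
qed

lemma diag_kernel_eq_split_walk_mean:
  "diag_kernel m p x q y = split_walk_mean p x q y (2 * m) (diag_weight (x * y) (x * y - p * q))"
proof -
  define w where "w a b = (if a + b = m then x * y else x * y - p * q)" for a b :: nat
  define t where "t A \<alpha> \<beta> = of_nat (A choose \<alpha>) * (p ^ \<alpha> * x ^ (A - \<alpha>)) *
    (of_nat ((2 * m - A) choose \<beta>) * (q ^ \<beta> * y ^ (2 * m - A - \<beta>)))" for A \<alpha> \<beta>
  let ?walks = "SIGMA A : {..2 * m}. SIGMA \<alpha> : {..A}. {..2 * m - A}"
  let ?meetings = "{(A, \<alpha>, \<beta>). A + \<beta> = \<alpha> + m \<and> \<alpha> + \<beta> \<le> m}"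
  have "split_walk_mean p x q y (2 * m) (diag_weight (x * y) (x * y - p * q)) =
      (\<Sum>A\<le>2 * m. \<Sum>\<alpha>\<le>A. \<Sum>\<beta>\<le>2 * m - A.
         t A \<alpha> \<beta> * (if A + \<beta> = \<alpha> + m \<and> \<alpha> + \<beta> \<le> m then w \<alpha> \<beta> else 0))"
    unfolding split_walk_mean_def walk_mean_eq_binomial_sum sum_distrib_left
    by (intro sum.cong refl, subst diag_weight_walk_positions[where m = m])
       (simp_all only: t_def w_def mult.assoc, auto)
  also have "\<dots> = (\<Sum>(A, \<alpha>, \<beta>)\<in>?walks.
         t A \<alpha> \<beta> * (if A + \<beta> = \<alpha> + m \<and> \<alpha> + \<beta> \<le> m then w \<alpha> \<beta> else 0))"
    by (simp add: sum.Sigma)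
  also have "\<dots> = (\<Sum>(A, \<alpha>, \<beta>)\<in>?meetings. t A \<alpha> \<beta> * w \<alpha> \<beta>)"
    by (rule sum.mono_neutral_cong_right) (auto split: if_splits)
  also have "\<dots> = (\<Sum>(a, b) | a + b \<le> m. t (m + a - b) a b * w a b)"
    by (rule sum.reindex_bij_witness[of _ "\<lambda>(a, b). (m + a - b, a, b)" "\<lambda>(A, \<alpha>, \<beta>). (\<alpha>, \<beta>)"])
       (auto, metis add.commute add_diff_cancel_right')
  also have "\<dots> = diag_kernel m p x q y"
    unfolding diag_kernel_def
  proof (intro sum.cong refl, clarify)
    fix a b :: nat assume "a + b \<le> m"
    then have "m + a - b - a = m - b" "2 * m - (m + a - b) = m + b - a" "m + b - a - b = m - a"
      by linarith+
    then show "t (m + a - b) a b * w a b =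
        of_nat ((m + a - b) choose a) * of_nat ((m + b - a) choose b) *
        (p ^ a * x ^ (m - b)) * (q ^ b * y ^ (m - a)) * (if a + b = m then x * y else x * y - p * q)"
      by (simp only: t_def w_def mult_ac)
  qed
  finally show ?thesis ..
qed

definition farther_out :: "int \<Rightarrow> int \<Rightarrow> 'a::zero_neq_one" where
  "farther_out X Y = of_bool (\<bar>Y\<bar> < \<bar>X\<bar>)"

lemma step_exchange_farther_out:
  fixes p x q y :: "'a::comm_ring_1"
  assumes "p + x = 1" and "q + y = 1" and even: "even (X + Y)"
  shows "step_exchange p x q y farther_out X Y =
     diag_weight (x * y) (x * y - p * q) X Y + diag_weight (p * y) (p * y - x * q) (- X) Y +
     (diag_weight (x * q) (x * q - p * y) X (- Y) + diag_weight (p * q) (p * q - x * y) (- X) (- Y))"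
proof -
  have p: "p = 1 - x" and q: "q = 1 - y"
    using assms(1,2) by (simp_all add: eq_diff_eq)
  have "even (\<bar>X\<bar> - \<bar>Y\<bar>)" using even by (auto simp: abs_if)
  then obtain k where k: "\<bar>X\<bar> - \<bar>Y\<bar> = 2 * k" ..
  consider (meeting) "k = 0" | (behind) "k < 0" | (ahead) "k > 0" by linarith
  then show ?thesis
  proof cases
    case meeting
    with k consider "X = 0 \<and> Y = 0" | "X = Y \<and> X > 0" | "X = Y \<and> X < 0" |
        "X = - Y \<and> X > 0" | "X = - Y \<and> X < 0"
      by linarith
    then show ?thesis
      by cases (auto simp: step_exchange_def farther_out_def diag_weight_def p q algebra_simps)
  next
    case behind
    with k have "\<bar>X\<bar> + 2 \<le> \<bar>Y\<bar>" by linarith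
    then show ?thesis by (auto simp: step_exchange_def farther_out_def diag_weight_def)
  next
    case ahead
    with k have "\<bar>Y\<bar> + 2 \<le> \<bar>X\<bar>" by linarith
    then show ?thesis by (auto simp: step_exchange_def farther_out_def diag_weight_def assms(1,2))
  qed
qed

lemma split_walk_mean_step_exchange_farther_out:
  assumes px: "p + x = 1" and qy: "q + y = 1"
  shows "split_walk_mean p x q y (2 * m) (step_exchange p x q y farther_out) = 1"
proof -
  have "walk_mean p x (Suc (2 * m)) (\<lambda>X. farther_out X 0) = walk_mean p x (Suc (2 * m)) (\<lambda>_. 1)"
    by (intro walk_mean_cong_parity) (auto simp: farther_out_def)
  moreover have "walk_mean q y (Suc (2 * m)) (farther_out 0) = walk_mean q y (Suc (2 * m)) (\<lambda>_. 0)"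
    by (intro walk_mean_cong_parity) (auto simp: farther_out_def)
  ultimately show ?thesis
    unfolding split_walk_mean_step_exchange by (simp only: walk_mean_const[OF px] walk_mean_const[OF qy] diff_zero)
qed

lemma diag_kernel_partition_of_unity:
  fixes p x q y :: "'a::comm_ring_1"
  assumes px: "p + x = 1" and qy: "q + y = 1"
  shows "diag_kernel m p x q y + diag_kernel m x p q y + (diag_kernel m p x y q + diag_kernel m x p y q) = 1"
proof -
  define w where "w = diag_weight (x * y) (x * y - p * q)"
  define w_fst where "w_fst = diag_weight (p * y) (p * y - x * q)"
  define w_snd where "w_snd = diag_weight (x * q) (x * q - p * y)"
  define w_both where "w_both = diag_weight (p * q) (p * q - x * y)"
  let ?E = "split_walk_mean p x q y (2 * m)"
  have "?E (\<lambda>X Y. w X Y + w_fst (- X) Y + (w_snd X (- Y) + w_both (- X) (- Y))) =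
      ?E (step_exchange p x q y farther_out)"
    unfolding w_def w_fst_def w_snd_def w_both_def
    by (intro split_walk_mean_cong_parity step_exchange_farther_out[symmetric] px qy) simp
  also have "\<dots> = 1"
    using px qy by (rule split_walk_mean_step_exchange_farther_out)
  finally have total: "?E (\<lambda>X Y. w X Y + w_fst (- X) Y + (w_snd X (- Y) + w_both (- X) (- Y))) = 1" .
  have "?E w = diag_kernel m p x q y"
    by (simp add: w_def diag_kernel_eq_split_walk_mean)
  moreover have "?E (\<lambda>X. w_fst (- X)) = diag_kernel m x p q y"
    unfolding w_fst_def diag_kernel_eq_split_walk_mean by (rule split_walk_mean_reflect_fst)
  moreover have "?E (\<lambda>X Y. w_snd X (- Y)) = diag_kernel m p x y q"
    unfolding w_snd_def diag_kernel_eq_split_walk_mean by (rule split_walk_mean_reflect_snd)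
  moreover have "?E (\<lambda>X Y. w_both (- X) (- Y)) = diag_kernel m x p y q"
    unfolding w_both_def diag_kernel_eq_split_walk_mean
    by (rule split_walk_mean_reflect_fst[where f = "\<lambda>X Y. diag_weight _ _ X (- Y)", THEN trans])
       (rule split_walk_mean_reflect_snd)
  ultimately show ?thesis
    using total by (simp add: split_walk_mean_add)
qed

section \<open>Laurent polynomials and symmetry\<close>

definition laurent_sum ::
  "(int \<times> int \<Rightarrow> real) \<Rightarrow> (int \<times> int) set \<Rightarrow> complex \<Rightarrow> complex \<Rightarrow> complex" where
  "laurent_sum c A z w = (\<Sum>\<alpha>\<in>A. of_real (c \<alpha>) * z powi fst \<alpha> * w powi snd \<alpha>)"

lemma laurent_sum_extend:
  assumes "finite B" "A \<subseteq> B"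
  shows "laurent_sum c A z w = laurent_sum (\<lambda>\<alpha>. if \<alpha> \<in> A then c \<alpha> else 0) B z w"
  unfolding laurent_sum_def using assms by (intro sum.mono_neutral_cong_left) auto

lemma laurent_symbolE:
  assumes "laurent_symbol f"
  obtains c A where "finite A" "\<And>z w. z \<noteq> 0 \<Longrightarrow> w \<noteq> 0 \<Longrightarrow> f z w = laurent_sum c A z w"
  using assms unfolding laurent_symbol_def laurent_sum_def by blast

lemma laurent_symbolI:
  assumes "finite A" "\<And>z w. z \<noteq> 0 \<Longrightarrow> w \<noteq> 0 \<Longrightarrow> f z w = laurent_sum c A z w"
  shows "laurent_symbol f"
proof -
  define c' where "c' \<alpha> = (if \<alpha> \<in> A then c \<alpha> else 0)" for \<alpha>
  have support: "{\<alpha>. c' \<alpha> \<noteq> 0} \<subseteq> A" by (auto simp: c'_def)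
  have "f z w = (\<Sum>\<alpha> | c' \<alpha> \<noteq> 0. of_real (c' \<alpha>) * z powi fst \<alpha> * w powi snd \<alpha>)"
    if "z \<noteq> 0" "w \<noteq> 0" for z w
    unfolding assms(2)[OF that] laurent_sum_def
    using assms(1) support by (intro sum.mono_neutral_cong_right) (auto simp: c'_def)
  then show ?thesis
    unfolding laurent_symbol_def
    by (intro exI[of _ c'] conjI allI impI finite_subset[OF support assms(1)])
qed

lemma laurent_symbol_monomial: "laurent_symbol (\<lambda>z w. of_real k * z powi i * w powi j)"
  by (rule laurent_symbolI[of "{(i, j)}" _ "\<lambda>_. k"]) (simp_all add: laurent_sum_def)

lemma laurent_symbol_const: "laurent_symbol (\<lambda>z w. of_real k)"
  using laurent_symbol_monomial[of k 0 0] by simp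

lemma laurent_symbol_cong:
  assumes "laurent_symbol f" "\<And>z w. z \<noteq> 0 \<Longrightarrow> w \<noteq> 0 \<Longrightarrow> f z w = g z w"
  shows "laurent_symbol g"
  using assms unfolding laurent_symbol_def by simp

lemma laurent_symbol_add:
  assumes "laurent_symbol f" "laurent_symbol g"
  shows "laurent_symbol (\<lambda>z w. f z w + g z w)"
proof -
  obtain a A where A: "finite A" and f: "\<And>z w. z \<noteq> 0 \<Longrightarrow> w \<noteq> 0 \<Longrightarrow> f z w = laurent_sum a A z w"
    using laurent_symbolE[OF assms(1)] by metis
  obtain b B where B: "finite B" and g: "\<And>z w. z \<noteq> 0 \<Longrightarrow> w \<noteq> 0 \<Longrightarrow> g z w = laurent_sum b B z w"
    using laurent_symbolE[OF assms(2)] by metis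
  have fin: "finite (A \<union> B)" using A B by simp
  show ?thesis
  proof (rule laurent_symbolI[OF fin])
    fix z w :: complex assume zw: "z \<noteq> 0" "w \<noteq> 0"
    show "f z w + g z w =
        laurent_sum (\<lambda>\<alpha>. (if \<alpha> \<in> A then a \<alpha> else 0) + (if \<alpha> \<in> B then b \<alpha> else 0)) (A \<union> B) z w"
      unfolding f[OF zw] g[OF zw] laurent_sum_extend[OF fin Un_upper1] laurent_sum_extend[OF fin Un_upper2]
      by (simp add: laurent_sum_def distrib_right flip: sum.distrib)
  qed
qed

lemma laurent_symbol_sum:
  "(\<And>i. i \<in> I \<Longrightarrow> laurent_symbol (f i)) \<Longrightarrow> laurent_symbol (\<lambda>z w. \<Sum>i\<in>I. f i z w)"
  by (induction I rule: infinite_finite_induct)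
     (use laurent_symbol_const[of 0] in \<open>auto intro: laurent_symbol_add\<close>)

lemma laurent_symbol_mult:
  assumes "laurent_symbol f" "laurent_symbol g"
  shows "laurent_symbol (\<lambda>z w. f z w * g z w)"
proof -
  obtain a A where f: "\<And>z w. z \<noteq> 0 \<Longrightarrow> w \<noteq> 0 \<Longrightarrow> f z w = laurent_sum a A z w"
    using laurent_symbolE[OF assms(1)] by metis
  obtain b B where g: "\<And>z w. z \<noteq> 0 \<Longrightarrow> w \<noteq> 0 \<Longrightarrow> g z w = laurent_sum b B z w"
    using laurent_symbolE[OF assms(2)] by metis
  have "laurent_symbol (\<lambda>z w. \<Sum>\<alpha>\<in>A. \<Sum>\<beta>\<in>B.
      of_real (a \<alpha> * b \<beta>) * z powi (fst \<alpha> + fst \<beta>) * w powi (snd \<alpha> + snd \<beta>))"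
    by (intro laurent_symbol_sum laurent_symbol_monomial)
  then show ?thesis
    by (rule laurent_symbol_cong) (simp add: f g laurent_sum_def sum_product power_int_add mult_ac)
qed

lemma laurent_symbol_diff:
  assumes "laurent_symbol f" "laurent_symbol g"
  shows "laurent_symbol (\<lambda>z w. f z w - g z w)"
  using laurent_symbol_add[OF assms(1) laurent_symbol_mult[OF laurent_symbol_const[of "- 1"] assms(2)]]
  by simp

lemma laurent_symbol_power: "laurent_symbol f \<Longrightarrow> laurent_symbol (\<lambda>z w. f z w ^ k)"
  by (induction k) (use laurent_symbol_const[of 1] in \<open>auto intro: laurent_symbol_mult\<close>)

lemma laurent_symbol_swap:
  assumes "laurent_symbol f"
  shows "laurent_symbol (\<lambda>z w. f w z)"
proof -
  obtain a A where f: "\<And>z w. z \<noteq> 0 \<Longrightarrow> w \<noteq> 0 \<Longrightarrow> f z w = laurent_sum a A z w"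
    using laurent_symbolE[OF assms] by metis
  have "laurent_symbol (\<lambda>z w. \<Sum>\<alpha>\<in>A. of_real (a \<alpha>) * z powi snd \<alpha> * w powi fst \<alpha>)"
    by (intro laurent_symbol_sum laurent_symbol_monomial)
  then show ?thesis
    by (rule laurent_symbol_cong) (simp add: f laurent_sum_def mult_ac)
qed

lemma laurent_symbol_sigma_fun: "laurent_symbol (\<lambda>z w. sigma_fun z)"
proof -
  have "laurent_symbol (\<lambda>z w. of_real (1 / 4) * z powi 1 * w powi 0 + of_real (1 / 2) +
      of_real (1 / 4) * z powi (- 1) * w powi 0)"
    by (intro laurent_symbol_add laurent_symbol_monomial laurent_symbol_const)
  then show ?thesis
    by (rule laurent_symbol_cong)
       (simp add: sigma_fun_def power_int_minus field_simps power2_eq_square)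
qed

lemma laurent_symbol_delta_fun: "laurent_symbol (\<lambda>z w. delta_fun z)"
proof -
  have "laurent_symbol (\<lambda>z w. of_real 1 - sigma_fun z)"
    by (intro laurent_symbol_diff laurent_symbol_const laurent_symbol_sigma_fun)
  then show ?thesis
    by (rule laurent_symbol_cong)
       (simp add: sigma_fun_def delta_fun_def field_simps power2_eq_square)
qed

lemmas laurent_symbol_intros =
  laurent_symbol_const laurent_symbol_add laurent_symbol_diff laurent_symbol_mult
  laurent_symbol_power laurent_symbol_sum laurent_symbol_sigma_fun laurent_symbol_delta_fun
  laurent_symbol_swap[OF laurent_symbol_sigma_fun] laurent_symbol_swap[OF laurent_symbol_delta_fun]

lemma laurent_symbol_S_fun: "laurent_symbol S_fun"
  unfolding S_fun_def[abs_def] by (intro laurent_symbol_intros)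

lemma laurent_symbol_G_fun: "laurent_symbol G_fun"
  unfolding G_fun_def[abs_def] by (intro laurent_symbol_intros)

lemma laurent_symbol_a_tilde: "laurent_symbol (a_tilde m)"
proof -
  have "laurent_symbol (\<lambda>z w. of_real 4 * S_fun z w ^ nat \<lceil>real m / 2\<rceil> * G_fun z w ^ nat \<lfloor>real m / 2\<rfloor>)"
    by (intro laurent_symbol_intros laurent_symbol_S_fun laurent_symbol_G_fun)
  then show ?thesis by (simp add: a_tilde_def[abs_def])
qed

lemma laurent_symbol_b_fun: "laurent_symbol (b_fun n i)"
  unfolding b_fun_def[abs_def] by (intro laurent_symbol_intros)

lemma laurent_symbol_a_family: "laurent_symbol (a_family n l)"
  unfolding a_family_def[abs_def]
  by (intro laurent_symbol_intros laurent_symbol_a_tilde laurent_symbol_b_fun)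

lemma sigma_fun_inverse: "sigma_fun (1 / z) = sigma_fun z"
  by (cases "z = 0") (simp_all add: sigma_fun_def field_simps power2_eq_square)

lemma delta_fun_inverse: "delta_fun (1 / z) = delta_fun z"
  by (cases "z = 0") (simp_all add: delta_fun_def field_simps power2_eq_square)

lemma coeff_c_flip: "j \<le> i \<Longrightarrow> coeff_c n i (i - j) = coeff_c n i j"
  unfolding coeff_c_def by (rule sum.cong) (simp_all add: of_nat_diff algebra_simps)

lemma b_fun_swap: "b_fun n i z1 z2 = b_fun n i z2 z1"
  unfolding b_fun_def
  by (rule sum.reindex_bij_witness[of _ "\<lambda>j. i - j" "\<lambda>j. i - j"]) (auto simp: coeff_c_flip mult_ac)

lemma a_tilde_swap: "a_tilde m z1 z2 = a_tilde m z2 z1"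
  by (simp add: a_tilde_def S_fun_def G_fun_def mult.commute)

lemma symbol_symmetric_a_family: "symbol_symmetric (a_family n l)"
proof -
  have "a_family n l z1 z2 = a_family n l z2 z1" for z1 z2
    unfolding a_family_def a_tilde_swap[of _ z1 z2] b_fun_swap[of _ _ z1 z2] ..
  then show ?thesis
    by (simp add: symbol_symmetric_def a_family_def a_tilde_def S_fun_def G_fun_def b_fun_def
        sigma_fun_inverse delta_fun_inverse)
qed

section \<open>The interpolatory symbols\<close>

lemma sigma_fun_minus: "sigma_fun (- z) = delta_fun z"
  by (simp add: sigma_fun_def delta_fun_def)

lemma delta_fun_minus: "delta_fun (- z) = sigma_fun z"
  by (simp add: sigma_fun_def delta_fun_def)

lemma delta_plus_sigma: "z \<noteq> 0 \<Longrightarrow> delta_fun z + sigma_fun z = 1"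
  by (simp add: sigma_fun_def delta_fun_def field_simps power2_eq_square)

lemma a_tilde_eq:
  "a_tilde m z1 z2 = 4 * S_fun z1 z2 ^ ((m + 1) div 2) * G_fun z1 z2 ^ (m div 2)"
proof -
  have "\<lceil>real m / 2\<rceil> = int ((m + 1) div 2)"
    by (cases "even m") (auto simp: ceiling_eq_iff elim!: evenE oddE)
  moreover have "\<lfloor>real m / 2\<rfloor> = int (m div 2)"
    using floor_divide_of_nat_eq[of m 2] by simp
  ultimately show ?thesis by (simp only: a_tilde_def nat_int)
qed

lemma int_binom_of_nat: "int_binom (int p) (int q) = of_nat (p choose q)"
  by (simp add: int_binom_def binomial_gbinomial)

lemma int_binom_diff:
  "int_binom (int p) (int a - int k) = (if k \<le> a then of_nat (p choose (a - k)) else 0)"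
proof (cases "k \<le> a")
  case True
  then have "int a - int k = int (a - k)" by simp
  then show ?thesis using True by (simp only: int_binom_of_nat if_True)
qed (simp add: int_binom_def)

lemma int_binom_add_pred:
  "int_binom (int M + int k - 1) (int k) = of_nat ((M + k - 1) choose k)"
proof (cases "M + k = 0")
  case False
  then have "int M + int k - 1 = int (M + k - 1)" by linarith
  then show ?thesis by (simp only: int_binom_of_nat)
qed (simp add: int_binom_def)

lemma coeff_c_eq_binomial_sum:
  assumes "a + b \<le> m"
  shows "coeff_c (Suc m) (a + b) a =
     (\<Sum>k\<le>min a b. of_nat (((Suc m - (a + b)) div 2 + k - 1) choose k) *
        (of_nat ((m + a - b) choose (a - k)) * of_nat ((m + b - a) choose (b - k))))"
proof -
  have args: "(int (Suc m) - int (a + b)) div 2 = int ((Suc m - (a + b)) div 2)"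
    "int (Suc m) + int (a + b) - 2 * int a - 1 = int (m + b - a)"
    "int (Suc m) + 2 * int a - int (a + b) - 1 = int (m + a - b)"
    "int (a + b) - int a - int k = int b - int k" for k
    using assms by (auto simp: of_nat_diff zdiv_int)
  have "coeff_c (Suc m) (a + b) a =
     (\<Sum>k = 0..(a + b) div 2. of_nat (((Suc m - (a + b)) div 2 + k - 1) choose k) *
        int_binom (int (m + b - a)) (int b - int k) * int_binom (int (m + a - b)) (int a - int k))"
    unfolding coeff_c_def args int_binom_add_pred ..
  also have "\<dots> = (\<Sum>k\<le>min a b. of_nat (((Suc m - (a + b)) div 2 + k - 1) choose k) *
        (of_nat ((m + a - b) choose (a - k)) * of_nat ((m + b - a) choose (b - k))))"
    by (rule sum.mono_neutral_cong_right)
       (auto simp: int_binom_diff)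
  finally show ?thesis .
qed

text \<open>
  The contribution of the \<open>k\<close>-th term of \<open>coeff_c (Suc m) (a + b) a\<close> to a quarter of the symbol.
\<close>

definition collapse_summand :: "nat \<Rightarrow> 'a::comm_ring_1 \<Rightarrow> 'a \<Rightarrow> 'a \<Rightarrow> 'a \<Rightarrow> nat \<Rightarrow> nat \<Rightarrow> nat \<Rightarrow> 'a" where
  "collapse_summand m p x q y a b k =
     of_nat (((Suc m - (a + b)) div 2 + k - 1) choose k) *
     (of_nat ((m + a - b) choose (a - k)) * of_nat ((m + b - a) choose (b - k))) *
     ((x * y) ^ ((m + 2 - (a + b)) div 2) * (x * y - p * q) ^ ((Suc m - (a + b)) div 2)) *
     ((x * p) ^ a * (y * q) ^ b)"

lemma a_tilde_mult_b_fun: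
  assumes "i \<le> m"
  shows "a_tilde (Suc m - i) z1 z2 * b_fun (Suc m) i z1 z2 =
    4 * (\<Sum>a\<le>i. \<Sum>k\<le>min a (i - a). collapse_summand m
       (delta_fun z1) (sigma_fun z1) (delta_fun z2) (sigma_fun z2) a (i - a) k)"
proof -
  have half: "(Suc m - i + 1) div 2 = (m + 2 - i) div 2"
    using assms by (simp add: Suc_diff_le)
  have "b_fun (Suc m) i z1 z2 = (\<Sum>a\<le>i. of_real (coeff_c (Suc m) i a) *
      ((sigma_fun z1 * delta_fun z1) ^ a * (sigma_fun z2 * delta_fun z2) ^ (i - a)))"
    unfolding b_fun_swap[of _ _ z1] by (simp add: b_fun_def atLeast0AtMost mult_ac)
  also have "\<dots> = (\<Sum>a\<le>i. \<Sum>k\<le>min a (i - a). of_nat (((Suc m - i) div 2 + k - 1) choose k) *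
      (of_nat ((m + a - (i - a)) choose (a - k)) * of_nat ((m + (i - a) - a) choose (i - a - k))) *
      ((sigma_fun z1 * delta_fun z1) ^ a * (sigma_fun z2 * delta_fun z2) ^ (i - a)))"
  proof (intro sum.cong refl)
    fix a assume "a \<in> {..i}"
    then have "a + (i - a) = i" by simp
    then show "of_real (coeff_c (Suc m) i a) *
        ((sigma_fun z1 * delta_fun z1) ^ a * (sigma_fun z2 * delta_fun z2) ^ (i - a)) =
      (\<Sum>k\<le>min a (i - a). of_nat (((Suc m - i) div 2 + k - 1) choose k) *
        (of_nat ((m + a - (i - a)) choose (a - k)) * of_nat ((m + (i - a) - a) choose (i - a - k))) *
        ((sigma_fun z1 * delta_fun z1) ^ a * (sigma_fun z2 * delta_fun z2) ^ (i - a)))"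
      using coeff_c_eq_binomial_sum[of a "i - a" m] assms by (simp add: sum_distrib_right)
  qed
  finally show ?thesis
    unfolding a_tilde_eq half S_fun_def G_fun_def collapse_summand_def
    by (simp add: sum_distrib_left mult_ac)
qed

lemma sum_pairs_diagonal_shift:
  fixes t :: "nat \<Rightarrow> nat \<Rightarrow> nat \<Rightarrow> 'a::comm_monoid_add"
  shows "(\<Sum>(a, b) | a + b \<le> m. \<Sum>k\<le>min a b. t a b k) =
    (\<Sum>(a, b) | a + b \<le> m. \<Sum>k\<le>(m - (a + b)) div 2. t (a + k) (b + k) k)"
proof -
  let ?P = "{(a, b). a + b \<le> m}"
  have fin: "finite ?P"
    by (rule finite_subset[of _ "{..m} \<times> {..m}"]) auto
  have "(\<Sum>(a, b)\<in>?P. \<Sum>k\<le>min a b. t a b k) =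
      (\<Sum>((a, b), k)\<in>(SIGMA ab : ?P. {..min (fst ab) (snd ab)}). t a b k)"
    using fin by (simp add: sum.Sigma case_prod_unfold)
  also have "\<dots> = (\<Sum>((a, b), k)\<in>(SIGMA ab : ?P. {..(m - (fst ab + snd ab)) div 2}). t (a + k) (b + k) k)"
    by (rule sum.reindex_bij_witness[of _ "\<lambda>((a, b), k). ((a + k, b + k), k)"
          "\<lambda>((a, b), k). ((a - k, b - k), k)"]) auto
  also have "\<dots> = (\<Sum>(a, b)\<in>?P. \<Sum>k\<le>(m - (a + b)) div 2. t (a + k) (b + k) k)"
    using fin by (simp add: sum.Sigma case_prod_unfold)
  finally show ?thesis .
qed

lemma binomial_collapse:
  fixes S G D :: "'a::comm_ring_1"
  assumes "G + D = S"
  shows "(\<Sum>k\<le>r div 2. of_nat ((Suc r div 2 - 1) choose k) * D ^ k * G ^ (Suc r div 2 - k)) *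
    S ^ Suc (r div 2) = S ^ r * (if r = 0 then S else G)"
proof (cases "r = 0")
  case False
  define N where "N = Suc r div 2 - 1"
  have N: "Suc r div 2 = Suc N" "r div 2 + Suc N = r" "N \<le> r div 2"
    using False by (auto simp: N_def)
  have "(\<Sum>k\<le>r div 2. of_nat (N choose k) * D ^ k * G ^ (Suc N - k)) =
      (\<Sum>k\<le>N. of_nat (N choose k) * D ^ k * G ^ (Suc N - k))"
    using N by (intro sum.mono_neutral_right) (auto simp: binomial_eq_0)
  also have "\<dots> = (\<Sum>k\<le>N. of_nat (N choose k) * D ^ k * G ^ (N - k)) * G"
    by (simp add: sum_distrib_left Suc_diff_le mult_ac)
  also have "\<dots> = S ^ N * G"
    using binomial_ring[of D G N] assms by (simp add: add.commute)
  also have "S ^ N * G * S ^ Suc (r div 2) = S ^ (r div 2 + Suc N) * G"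
    by (simp add: power_add mult_ac)
  finally show ?thesis
    using False N by (simp only: diff_Suc_1 if_False)
qed simp

lemma collapse_summand_diagonal_shift:
  assumes "a + b + r = m" "k \<le> r div 2"
  shows "collapse_summand m p x q y (a + k) (b + k) k =
    of_nat ((m + a - b) choose a) * of_nat ((m + b - a) choose b) * ((x * p) ^ a * (y * q) ^ b) *
    (of_nat ((Suc r div 2 - 1) choose k) * (p * q) ^ k * (x * y - p * q) ^ (Suc r div 2 - k) *
      (x * y) ^ Suc (r div 2))"
proof -
  have exps: "(Suc m - (a + k + (b + k))) div 2 = Suc r div 2 - k" "Suc r div 2 - k + k = Suc r div 2"
    "(m + 2 - (a + k + (b + k))) div 2 = Suc (r div 2) - k"
    "m + (a + k) - (b + k) = m + a - b" "m + (b + k) - (a + k) = m + b - a"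
    using assms by linarith+
  have "(x * y) ^ Suc (r div 2) = (x * y) ^ (Suc (r div 2) - k) * (x * y) ^ k"
    using assms(2) by (simp flip: power_add)
  then have absorb: "(x * y) ^ (Suc (r div 2) - k) * ((x * p) ^ k * (y * q) ^ k) =
      (p * q) ^ k * (x * y) ^ Suc (r div 2)"
    by (simp only: power_mult_distrib mult_ac)
  have "collapse_summand m p x q y (a + k) (b + k) k =
      of_nat ((m + a - b) choose a) * of_nat ((m + b - a) choose b) * ((x * p) ^ a * (y * q) ^ b) *
      (of_nat ((Suc r div 2 - 1) choose k) * (x * y - p * q) ^ (Suc r div 2 - k) *
        ((x * y) ^ (Suc (r div 2) - k) * ((x * p) ^ k * (y * q) ^ k)))"
    by (simp only: collapse_summand_def exps add_diff_cancel_right' power_add mult_ac)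
  then show ?thesis unfolding absorb by (simp only: mult_ac)
qed

lemma sum_collapse_summand:
  assumes "a + b \<le> m"
  shows "(\<Sum>k\<le>(m - (a + b)) div 2. collapse_summand m p x q y (a + k) (b + k) k) =
    of_nat ((m + a - b) choose a) * of_nat ((m + b - a) choose b) *
    (p ^ a * x ^ (m - b)) * (q ^ b * y ^ (m - a)) * (if a + b = m then x * y else x * y - p * q)"
proof -
  define r where "r = m - (a + b)"
  then have r: "a + b + r = m" "r = 0 \<longleftrightarrow> a + b = m" using assms by auto
  have "(\<Sum>k\<le>r div 2. collapse_summand m p x q y (a + k) (b + k) k) =
      of_nat ((m + a - b) choose a) * of_nat ((m + b - a) choose b) * ((x * p) ^ a * (y * q) ^ b) *
      ((\<Sum>k\<le>r div 2. of_nat ((Suc r div 2 - 1) choose k) * (p * q) ^ k * (x * y - p * q) ^ (Suc r div 2 - k)) *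
        (x * y) ^ Suc (r div 2))"
    unfolding sum_distrib_left sum_distrib_right
    by (intro sum.cong refl collapse_summand_diagonal_shift r(1)) simp
  also have "\<dots> = of_nat ((m + a - b) choose a) * of_nat ((m + b - a) choose b) *
      ((x * p) ^ a * (y * q) ^ b) * ((x * y) ^ r * (if r = 0 then x * y else x * y - p * q))"
    by (subst binomial_collapse[where S = "x * y"]) simp_all
  also have "\<dots> = of_nat ((m + a - b) choose a) * of_nat ((m + b - a) choose b) *
      (p ^ a * x ^ (m - b)) * (q ^ b * y ^ (m - a)) * (if a + b = m then x * y else x * y - p * q)"
  proof -
    have "m - b = a + r" "m - a = b + r" using r(1) by auto
    then show ?thesis by (simp only: r(2) power_add power_mult_distrib mult_ac)
  qed
  finally show ?thesis by (simp only: r_def)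
qed

lemma a_family_eq_diag_kernel:
  "a_family (Suc m) m z1 z2 =
     4 * diag_kernel m (delta_fun z1) (sigma_fun z1) (delta_fun z2) (sigma_fun z2)"
proof -
  let ?t = "collapse_summand m (delta_fun z1) (sigma_fun z1) (delta_fun z2) (sigma_fun z2)"
  have "a_family (Suc m) m z1 z2 = 4 * (\<Sum>i\<le>m. \<Sum>a\<le>i. \<Sum>k\<le>min a (i - a). ?t a (i - a) k)"
    by (simp add: a_family_def atLeast0AtMost a_tilde_mult_b_fun sum_distrib_left)
  also have "(\<Sum>i\<le>m. \<Sum>a\<le>i. \<Sum>k\<le>min a (i - a). ?t a (i - a) k) =
      (\<Sum>(a, b) | a + b \<le> m. \<Sum>k\<le>min a b. ?t a b k)"
    by (rule sum.triangle_reindex_eq[symmetric])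
  also have "\<dots> = (\<Sum>(a, b) | a + b \<le> m. \<Sum>k\<le>(m - (a + b)) div 2. ?t (a + k) (b + k) k)"
    by (rule sum_pairs_diagonal_shift)
  also have "\<dots> = diag_kernel m (delta_fun z1) (sigma_fun z1) (delta_fun z2) (sigma_fun z2)"
    unfolding diag_kernel_def by (intro sum.cong refl) (auto simp: sum_collapse_summand)
  finally show ?thesis .
qed

lemma interpolatory_a_family: "interpolatory (a_family (Suc m) m)"
  unfolding interpolatory_def
proof (intro allI impI)
  fix z1 z2 :: complex assume "z1 \<noteq> 0" "z2 \<noteq> 0"
  then have "diag_kernel m (delta_fun z1) (sigma_fun z1) (delta_fun z2) (sigma_fun z2) +
     diag_kernel m (sigma_fun z1) (delta_fun z1) (delta_fun z2) (sigma_fun z2) +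
     (diag_kernel m (delta_fun z1) (sigma_fun z1) (sigma_fun z2) (delta_fun z2) +
     diag_kernel m (sigma_fun z1) (delta_fun z1) (sigma_fun z2) (delta_fun z2)) = 1" (is "?sum = 1")
    by (intro diag_kernel_partition_of_unity delta_plus_sigma)
  moreover have "a_family (Suc m) m z1 z2 + a_family (Suc m) m z1 (- z2) +
      a_family (Suc m) m (- z1) z2 + a_family (Suc m) m (- z1) (- z2) = 4 * ?sum"
    unfolding a_family_eq_diag_kernel sigma_fun_minus delta_fun_minus by (simp only: algebra_simps)
  ultimately show "a_family (Suc m) m z1 z2 + a_family (Suc m) m z1 (- z2) +
      a_family (Suc m) m (- z1) z2 + a_family (Suc m) m (- z1) (- z2) = 4" by simp
qed

section \<open>Order of vanishing at a point\<close>

text \<open>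
  Finite sums of separated products suffice here and spare the theory of analytic functions of two
  variables. Only the germ at the point counts, so junk values at $0$ are irrelevant.
\<close>

inductive vanishes_to_order :: "complex \<Rightarrow> complex \<Rightarrow> nat \<Rightarrow> (complex \<Rightarrow> complex \<Rightarrow> complex) \<Rightarrow> bool"
  for c d where
  separated: "\<phi> analytic_on {c} \<Longrightarrow> \<psi> analytic_on {d} \<Longrightarrow> N \<le> a + b \<Longrightarrow>
    vanishes_to_order c d N (\<lambda>z w. ((z - c) ^ a * \<phi> z) * ((w - d) ^ b * \<psi> w))"
| add: "vanishes_to_order c d N f \<Longrightarrow> vanishes_to_order c d N g \<Longrightarrow>
    vanishes_to_order c d N (\<lambda>z w. f z w + g z w)"
| cong: "vanishes_to_order c d N f \<Longrightarrow> \<forall>\<^sub>F (z, w) in nhds (c, d). f z w = g z w \<Longrightarrow>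
    vanishes_to_order c d N g"

lemma vanishes_to_order_cong_nonzero:
  assumes "vanishes_to_order c d N f" "c \<noteq> 0" "d \<noteq> 0"
    and "\<And>z w. z \<noteq> 0 \<Longrightarrow> w \<noteq> 0 \<Longrightarrow> f z w = g z w"
  shows "vanishes_to_order c d N g"
proof (rule vanishes_to_order.cong[OF assms(1)])
  show "\<forall>\<^sub>F (z, w) in nhds (c, d). f z w = g z w"
    unfolding nhds_prod eventually_prod_filter
    using t1_space_nhds[OF assms(2)] t1_space_nhds[OF assms(3)] assms(4)
    by (intro exI[of _ "\<lambda>z. z \<noteq> 0"] conjI) auto
qed

lemma eventually_nhds_Pair_iterated:
  assumes "\<forall>\<^sub>F (z, w) in nhds (c, d). P z w"
  shows "\<forall>\<^sub>F z in nhds c. \<forall>\<^sub>F w in nhds d. P z w"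
  using assms unfolding nhds_prod eventually_prod_filter
  by (auto elim!: eventually_mono)

lemma vanishes_to_order_mult:
  assumes "vanishes_to_order c d N f" "vanishes_to_order c d M g"
  shows "vanishes_to_order c d (N + M) (\<lambda>z w. f z w * g z w)"
  using assms
proof (induction rule: vanishes_to_order.induct)
  case (separated \<phi> \<psi> N a b)
  from separated.prems show ?case
  proof (induction rule: vanishes_to_order.induct)
    case (separated \<phi>' \<psi>' M a' b')
    have "vanishes_to_order c d (N + M)
        (\<lambda>z w. ((z - c) ^ (a + a') * (\<phi> z * \<phi>' z)) * ((w - d) ^ (b + b') * (\<psi> w * \<psi>' w)))"
      using \<open>\<phi> analytic_on _\<close> \<open>\<psi> analytic_on _\<close> \<open>N \<le> _\<close> separated
      by (intro vanishes_to_order.separated analytic_intros) auto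
    then show ?case by (simp add: power_add mult_ac)
  next
    case (add M f g)
    show ?case using vanishes_to_order.add[OF add.IH] by (simp add: distrib_left)
  next
    case (cong M f g)
    show ?case
      by (rule vanishes_to_order.cong[OF cong.IH]) (use cong.hyps in \<open>auto elim!: eventually_mono\<close>)
  qed
next
  case (add N f g)
  show ?case
    using vanishes_to_order.add[OF add.IH(1)[OF add.prems] add.IH(2)[OF add.prems]]
    by (simp add: distrib_right)
next
  case (cong N f g)
  show ?case
    by (rule vanishes_to_order.cong[OF cong.IH[OF cong.prems]])
       (use cong.hyps in \<open>auto elim!: eventually_mono\<close>)
qed

lemma vanishes_to_order_mono:
  "vanishes_to_order c d N f \<Longrightarrow> M \<le> N \<Longrightarrow> vanishes_to_order c d M f"
  by (induction rule: vanishes_to_order.induct) (auto intro: vanishes_to_order.intros)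

lemma vanishes_to_order_fst:
  assumes "\<phi> analytic_on {c}"
  shows "vanishes_to_order c d N (\<lambda>z w. (z - c) ^ N * \<phi> z)"
  using vanishes_to_order.separated[OF assms, of "\<lambda>_. 1" d N N 0] by simp

lemma vanishes_to_order_const: "vanishes_to_order c d 0 (\<lambda>z w. k)"
  using vanishes_to_order_fst[of "\<lambda>_. k" c d 0] by simp

lemma vanishes_to_order_cmult:
  "vanishes_to_order c d N f \<Longrightarrow> vanishes_to_order c d N (\<lambda>z w. k * f z w)"
  using vanishes_to_order_mult[OF vanishes_to_order_const, of c d N f k] by simp

lemma vanishes_to_order_diff:
  "vanishes_to_order c d N f \<Longrightarrow> vanishes_to_order c d N g \<Longrightarrow>
    vanishes_to_order c d N (\<lambda>z w. f z w - g z w)"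
  using vanishes_to_order.add[OF _ vanishes_to_order_cmult[of c d N g "- 1"]] by simp

lemma vanishes_to_order_power:
  "vanishes_to_order c d N f \<Longrightarrow> vanishes_to_order c d (N * k) (\<lambda>z w. f z w ^ k)"
  by (induction k) (auto simp: vanishes_to_order_const intro: vanishes_to_order_mult)

lemma vanishes_to_order_sum:
  "(\<And>i. i \<in> I \<Longrightarrow> vanishes_to_order c d N (f i)) \<Longrightarrow> vanishes_to_order c d N (\<lambda>z w. \<Sum>i\<in>I. f i z w)"
proof (induction I rule: infinite_finite_induct)
  case empty
  show ?case using vanishes_to_order_fst[of "\<lambda>_. 0" c d N] by simp
next
  case (infinite I)
  show ?case using infinite vanishes_to_order_fst[of "\<lambda>_. 0" c d N] by simp
qed (auto intro: vanishes_to_order.add)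

lemma vanishes_to_order_swap:
  "vanishes_to_order c d N f \<Longrightarrow> vanishes_to_order d c N (\<lambda>z w. f w z)"
proof (induction rule: vanishes_to_order.induct)
  case (separated \<phi> \<psi> N a b)
  have "vanishes_to_order d c N (\<lambda>z w. ((z - d) ^ b * \<psi> z) * ((w - c) ^ a * \<phi> w))"
    using separated by (intro vanishes_to_order.separated) auto
  then show ?case by (simp add: mult_ac)
next
  case (cong N f g)
  have "((\<lambda>p. (snd p, fst p)) \<longlongrightarrow> (c, d)) (nhds (d, c))"
    by (auto intro!: tendsto_eq_intros filterlim_ident)
  from eventually_compose_filterlim[OF cong.hyps(2) this]
  show ?case by (intro vanishes_to_order.cong[OF cong.IH]) (simp add: case_prod_unfold)
qed (intro vanishes_to_order.add)

lemma vanishes_to_order_uminus_fst: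
  "vanishes_to_order c d N f \<Longrightarrow> vanishes_to_order (- c) d N (\<lambda>z w. f (- z) w)"
proof (induction rule: vanishes_to_order.induct)
  case (separated \<phi> \<psi> N a b)
  have "(\<phi> \<circ> uminus) analytic_on {- c}"
    using separated by (intro analytic_on_compose analytic_intros) auto
  then have "vanishes_to_order (- c) d N
      (\<lambda>z w. ((z - - c) ^ a * ((- 1) ^ a * (\<phi> \<circ> uminus) z)) * ((w - d) ^ b * \<psi> w))"
    using separated by (intro vanishes_to_order.separated analytic_intros)
  moreover have "(- z - c) ^ a = (z - - c) ^ a * (- 1) ^ a" for z
    by (simp flip: power_mult_distrib)
  ultimately show ?case by (simp add: mult_ac)
next
  case (cong N f g)
  have "((\<lambda>p. (- fst p, snd p)) \<longlongrightarrow> (c, d)) (nhds (- c, d))"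
    by (auto intro!: tendsto_eq_intros filterlim_ident)
  from eventually_compose_filterlim[OF cong.hyps(2) this]
  show ?case by (intro vanishes_to_order.cong[OF cong.IH]) (simp add: case_prod_unfold)
qed (intro vanishes_to_order.add)

lemma vanishes_to_order_uminus_snd:
  "vanishes_to_order c d N f \<Longrightarrow> vanishes_to_order c (- d) N (\<lambda>z w. f z (- w))"
  using vanishes_to_order_swap[OF vanishes_to_order_uminus_fst[OF vanishes_to_order_swap]] .

lemma vanishes_to_order_laurent_symbol:
  assumes "laurent_symbol f" "c \<noteq> 0" "d \<noteq> 0"
  shows "vanishes_to_order c d 0 f"
proof -
  obtain a A where f: "\<And>z w. z \<noteq> 0 \<Longrightarrow> w \<noteq> 0 \<Longrightarrow> f z w = laurent_sum a A z w"
    using laurent_symbolE[OF assms(1)] by metis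
  have "vanishes_to_order c d 0 (\<lambda>z w. of_real (a \<alpha>) * z powi fst \<alpha> * w powi snd \<alpha>)" for \<alpha>
  proof -
    have "vanishes_to_order c d 0
        (\<lambda>z w. ((z - c) ^ 0 * (of_real (a \<alpha>) * z powi fst \<alpha>)) * ((w - d) ^ 0 * w powi snd \<alpha>))"
      by (intro vanishes_to_order.separated analytic_intros) (use assms(2,3) in auto)
    then show ?thesis by simp
  qed
  then have "vanishes_to_order c d 0 (\<lambda>z w. \<Sum>\<alpha>\<in>A. of_real (a \<alpha>) * z powi fst \<alpha> * w powi snd \<alpha>)"
    by (rule vanishes_to_order_sum)
  then show ?thesis
    using assms(2,3) by (rule vanishes_to_order_cong_nonzero) (simp add: f laurent_sum_def)
qed

lemma higher_deriv_zero_of_power_factor: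
  assumes "\<phi> analytic_on {c}" "k < a"
  shows "(deriv ^^ k) (\<lambda>z. (z - c) ^ a * \<phi> z) c = (0::complex)"
proof -
  have "(deriv ^^ k) (\<lambda>z. (z - c) ^ a * \<phi> z) c =
     (\<Sum>j = 0..k. of_nat (k choose j) * (deriv ^^ j) (\<lambda>z. (z - c) ^ a) c * (deriv ^^ (k - j)) \<phi> c)"
    using assms by (intro higher_deriv_mult_at analytic_intros) auto
  also have "\<dots> = 0"
    using assms(2) by (intro sum.neutral) (auto simp: higher_deriv_power)
  finally show ?thesis .
qed

lemma partial_D_separated:
  assumes "\<phi> analytic_on {c}" "\<psi> analytic_on {d}"
  shows "partial_D k1 k2 (\<lambda>z w. \<phi> z * \<psi> w) c d = (deriv ^^ k1) \<phi> c * (deriv ^^ k2) \<psi> d"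
  using higher_deriv_cmult'[OF assms(1), of k1 "(deriv ^^ k2) \<psi> d"]
  by (simp add: partial_D_def higher_deriv_cmult'[OF assms(2)] mult.commute)

lemma partial_D_cong:
  assumes "\<forall>\<^sub>F (z, w) in nhds (c, d). f z w = g z w"
  shows "partial_D k1 k2 f c d = partial_D k1 k2 g c d"
  unfolding partial_D_def
  by (intro higher_deriv_cong_ev refl eventually_mono[OF eventually_nhds_Pair_iterated[OF assms]])

lemma vanishes_to_order_imp_analytic_snd:
  assumes "vanishes_to_order c d N f"
  shows "\<forall>\<^sub>F z in nhds c. f z analytic_on {d}"
  using assms
proof (induction rule: vanishes_to_order.induct)
  case (separated \<phi> \<psi> N a b)
  then show ?case by (intro always_eventually allI analytic_intros)
next
  case (add N f g)
  from add.IH show ?case by eventually_elim (rule analytic_on_add)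
next
  case (cong N f g)
  from cong.IH eventually_nhds_Pair_iterated[OF cong.hyps(2)] show ?case
    by eventually_elim (simp cong: analytic_at_cong)
qed

lemma higher_deriv_snd_add:
  assumes "vanishes_to_order c d N f" "vanishes_to_order c d M g"
  shows "\<forall>\<^sub>F z in nhds c. (deriv ^^ k) (\<lambda>w. f z w + g z w) d = (deriv ^^ k) (f z) d + (deriv ^^ k) (g z) d"
  using assms[THEN vanishes_to_order_imp_analytic_snd]
  by eventually_elim (rule higher_deriv_add_at)

lemma vanishes_to_order_imp_analytic_higher_deriv_snd:
  assumes "vanishes_to_order c d N f"
  shows "(\<lambda>z. (deriv ^^ k) (f z) d) analytic_on {c}"
  using assms
proof (induction rule: vanishes_to_order.induct)
  case (separated \<phi> \<psi> N a b)
  then have "(deriv ^^ k) (\<lambda>w. ((z - c) ^ a * \<phi> z) * ((w - d) ^ b * \<psi> w)) d =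
        ((z - c) ^ a * \<phi> z) * (deriv ^^ k) (\<lambda>w. (w - d) ^ b * \<psi> w) d" for z
    by (intro higher_deriv_cmult' analytic_intros)
  then show ?case
    using separated by (auto intro!: analytic_intros)
next
  case (add N f g)
  show ?case
    using analytic_on_add[OF add.IH] analytic_at_cong[OF higher_deriv_snd_add[OF add.hyps] refl] by simp
next
  case (cong N f g)
  from eventually_nhds_Pair_iterated[OF cong.hyps(2)]
  have "\<forall>\<^sub>F z in nhds c. (deriv ^^ k) (f z) d = (deriv ^^ k) (g z) d"
    by eventually_elim (auto intro: higher_deriv_cong_ev)
  from cong.IH analytic_at_cong[OF this refl] show ?case by simp
qed

lemma partial_D_add:
  assumes "vanishes_to_order c d N f" "vanishes_to_order c d M g"
  shows "partial_D k1 k2 (\<lambda>z w. f z w + g z w) c d = partial_D k1 k2 f c d + partial_D k1 k2 g c d"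
proof -
  have "partial_D k1 k2 (\<lambda>z w. f z w + g z w) c d =
     (deriv ^^ k1) (\<lambda>z. (deriv ^^ k2) (f z) d + (deriv ^^ k2) (g z) d) c"
    unfolding partial_D_def by (intro higher_deriv_cong_ev higher_deriv_snd_add[OF assms] refl)
  also have "\<dots> = partial_D k1 k2 f c d + partial_D k1 k2 g c d"
    unfolding partial_D_def
    by (intro higher_deriv_add_at vanishes_to_order_imp_analytic_higher_deriv_snd[OF assms(1)]
        vanishes_to_order_imp_analytic_higher_deriv_snd[OF assms(2)])
  finally show ?thesis .
qed

lemma partial_D_eq_0_of_vanishes_to_order:
  assumes "vanishes_to_order c d N f" "k1 + k2 < N"
  shows "partial_D k1 k2 f c d = 0"
  using assms
proof (induction rule: vanishes_to_order.induct)
  case (separated \<phi> \<psi> N a b)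
  then have "partial_D k1 k2 (\<lambda>z w. ((z - c) ^ a * \<phi> z) * ((w - d) ^ b * \<psi> w)) c d =
     (deriv ^^ k1) (\<lambda>z. (z - c) ^ a * \<phi> z) c * (deriv ^^ k2) (\<lambda>w. (w - d) ^ b * \<psi> w) d"
    by (intro partial_D_separated analytic_intros)
  moreover have "k1 < a \<or> k2 < b" using separated by linarith
  ultimately show ?case
    using separated higher_deriv_zero_of_power_factor by auto
next
  case (add N f g)
  then show ?case by (simp add: partial_D_add)
next
  case (cong N f g)
  then show ?case using partial_D_cong[OF cong.hyps(2)] by simp
qed

lemma value_eq_0_of_vanishes_to_order:
  assumes "vanishes_to_order c d N f" "N > 0"
  shows "f c d = 0"
  using partial_D_eq_0_of_vanishes_to_order[OF assms(1), of 0 0] assms(2) by (simp add: partial_D_def)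

lemma partial_D_eq_0_of_vanishes_to_order_diff_const:
  assumes "vanishes_to_order c d N (\<lambda>z w. f z w - k)" "0 < k1 + k2" "k1 + k2 < N"
  shows "partial_D k1 k2 f c d = 0"
proof -
  have "partial_D k1 k2 (\<lambda>z w. (f z w - k) + k) c d =
      partial_D k1 k2 (\<lambda>z w. f z w - k) c d + partial_D k1 k2 (\<lambda>z w. k) c d"
    by (rule partial_D_add[OF assms(1) vanishes_to_order_const])
  also have "partial_D k1 k2 (\<lambda>z w. f z w - k) c d = 0"
    using assms(1,3) by (rule partial_D_eq_0_of_vanishes_to_order)
  also have "partial_D k1 k2 (\<lambda>z w. k) c d = 0"
    using assms(2) by (auto simp: partial_D_def)
  finally show ?thesis by simp
qed

section \<open>Generation and reproduction\<close>

abbreviation corners :: "(complex \<times> complex) set" where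
  "corners \<equiv> {(- 1, 1), (1, - 1), (- 1, - 1)}"

lemma generates_polysI:
  assumes "\<And>c d. (c, d) \<in> corners \<Longrightarrow> vanishes_to_order c d (Suc m) a"
  shows "generates_polys a m"
  unfolding generates_polys_def
  by (auto intro!: partial_D_eq_0_of_vanishes_to_order[OF assms])

lemma reproduces_polysI:
  assumes "generates_polys a m" "m' \<le> m"
    and "vanishes_to_order 1 1 (Suc m') (\<lambda>z w. a z w - 4)"
  shows "reproduces_polys a m'"
  unfolding reproduces_polys_def
  using assms value_eq_0_of_vanishes_to_order[OF assms(3)]
  by (auto intro: partial_D_eq_0_of_vanishes_to_order_diff_const[OF assms(3)])

lemma interpolatory_imp_vanishes_to_order:
  assumes "interpolatory a" and corners: "\<And>c d. (c, d) \<in> corners \<Longrightarrow> vanishes_to_order c d N a"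
  shows "vanishes_to_order 1 1 N (\<lambda>z w. a z w - 4)"
proof -
  have "vanishes_to_order 1 1 N (\<lambda>z w. a z (- w))"
    using vanishes_to_order_uminus_snd[OF corners[of 1 "- 1"]] by simp
  moreover have "vanishes_to_order 1 1 N (\<lambda>z w. a (- z) w)"
    using vanishes_to_order_uminus_fst[OF corners[of "- 1" 1]] by simp
  moreover have "vanishes_to_order 1 1 N (\<lambda>z w. a (- z) (- w))"
    using vanishes_to_order_uminus_fst[OF vanishes_to_order_uminus_snd[OF corners[of "- 1" "- 1"]]] by simp
  ultimately have "vanishes_to_order 1 1 N (\<lambda>z w. (- 1) * (a z (- w) + a (- z) w + a (- z) (- w)))"
    by (intro vanishes_to_order_cmult vanishes_to_order.add)
  then show ?thesis
  proof (rule vanishes_to_order_cong_nonzero)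
    fix z w :: complex assume "z \<noteq> 0" "w \<noteq> 0"
    with assms(1) have "a z w + a z (- w) + a (- z) w + a (- z) (- w) = 4"
      by (simp add: interpolatory_def)
    then show "(- 1) * (a z (- w) + a (- z) w + a (- z) (- w)) = a z w - 4"
      by (simp add: algebra_simps eq_diff_eq)
  qed simp_all
qed

lemma vanishes_to_order_sigma_fun: "vanishes_to_order (- 1) d 2 (\<lambda>z w. sigma_fun z)"
proof -
  have "vanishes_to_order (- 1) d 2 (\<lambda>z w. (z - - 1) ^ 2 * (1 / (4 * z)))"
    by (intro vanishes_to_order_fst analytic_intros) simp
  then show ?thesis by (simp add: sigma_fun_def add.commute)
qed

lemma vanishes_to_order_delta_fun: "vanishes_to_order 1 d 2 (\<lambda>z w. delta_fun z)"
  using vanishes_to_order_uminus_fst[OF vanishes_to_order_sigma_fun, of d] by (simp add: sigma_fun_minus)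

lemma vanishes_to_order_sigma_mult_delta:
  assumes "c \<in> {1, - 1}" "d \<noteq> 0"
  shows "vanishes_to_order c d 2 (\<lambda>z w. sigma_fun z * delta_fun z)"
proof -
  have sigma: "vanishes_to_order c d 0 (\<lambda>z w. sigma_fun z)"
    and delta: "vanishes_to_order c d 0 (\<lambda>z w. delta_fun z)"
    using assms by (auto intro!: vanishes_to_order_laurent_symbol laurent_symbol_intros)
  from assms(1) consider (one) "c = 1" | (minus_one) "c = - 1" by blast
  then show ?thesis
  proof cases
    case one
    show ?thesis
      unfolding one using vanishes_to_order_mult[OF sigma[unfolded one] vanishes_to_order_delta_fun]
      by (simp only: add_0_left)
  next
    case minus_one
    show ?thesis
      unfolding minus_one using vanishes_to_order_mult[OF vanishes_to_order_sigma_fun delta[unfolded minus_one]]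
      by (simp only: add_0_right)
  qed
qed

lemma vanishes_to_order_b_fun:
  assumes "c \<in> {1, - 1}" "d \<in> {1, - 1}"
  shows "vanishes_to_order c d (2 * i) (b_fun n i)"
  unfolding b_fun_def[abs_def]
proof (rule vanishes_to_order_sum)
  fix j assume "j \<in> {0..i}"
  have "c \<noteq> 0" "d \<noteq> 0" using assms by auto
  then have "vanishes_to_order c d (0 + 2 * (i - j) + 2 * j) (\<lambda>z w. of_real (coeff_c n i j) *
      (sigma_fun z * delta_fun z) ^ (i - j) * (sigma_fun w * delta_fun w) ^ j)"
    using assms by (intro vanishes_to_order_mult vanishes_to_order_power vanishes_to_order_const
        vanishes_to_order_sigma_mult_delta vanishes_to_order_swap[OF vanishes_to_order_sigma_mult_delta])
  then show "vanishes_to_order c d (2 * i) (\<lambda>z w. of_real (coeff_c n i j) *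
      (sigma_fun z * delta_fun z) ^ (i - j) * (sigma_fun w * delta_fun w) ^ j)"
    by (rule vanishes_to_order_mono) (use \<open>j \<in> {0..i}\<close> in simp)
qed

lemma vanishes_to_order_a_tilde:
  assumes "vanishes_to_order c d s S_fun" "vanishes_to_order c d g G_fun"
    and "N \<le> s * ((m + 1) div 2) + g * (m div 2)"
  shows "vanishes_to_order c d N (a_tilde m)"
proof -
  have "vanishes_to_order c d (0 + s * ((m + 1) div 2) + g * (m div 2))
     (\<lambda>z w. 4 * S_fun z w ^ ((m + 1) div 2) * G_fun z w ^ (m div 2))"
    by (intro vanishes_to_order_mult vanishes_to_order_power vanishes_to_order_const assms(1,2))
  then show ?thesis
    using assms(3) by (auto simp: a_tilde_eq[abs_def] intro: vanishes_to_order_mono)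
qed

lemma vanishes_to_order_a_tilde_neg_pos: "vanishes_to_order (- 1) 1 (2 * m) (a_tilde m)"
proof (rule vanishes_to_order_a_tilde)
  have "vanishes_to_order (- 1) 1 (2 + 0) (\<lambda>z w. sigma_fun z * sigma_fun w)"
    by (intro vanishes_to_order_mult vanishes_to_order_sigma_fun vanishes_to_order_laurent_symbol
        laurent_symbol_intros) auto
  then show S: "vanishes_to_order (- 1) 1 2 S_fun"
    by (simp add: S_fun_def[abs_def])
  have "vanishes_to_order (- 1) 1 (0 + 2) (\<lambda>z w. delta_fun z * delta_fun w)"
    by (intro vanishes_to_order_mult vanishes_to_order_swap[OF vanishes_to_order_delta_fun]
        vanishes_to_order_laurent_symbol laurent_symbol_intros) auto
  from vanishes_to_order_diff[OF S this[unfolded add_0]] show "vanishes_to_order (- 1) 1 2 G_fun"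
    by (simp add: S_fun_def G_fun_def[abs_def])
  show "2 * m \<le> 2 * ((m + 1) div 2) + 2 * (m div 2)" by presburger
qed

lemma vanishes_to_order_a_tilde_neg_neg: "vanishes_to_order (- 1) (- 1) (2 * m) (a_tilde m)"
proof (rule vanishes_to_order_a_tilde)
  have "vanishes_to_order (- 1) (- 1) (2 + 2) (\<lambda>z w. sigma_fun z * sigma_fun w)"
    by (intro vanishes_to_order_mult vanishes_to_order_sigma_fun
        vanishes_to_order_swap[OF vanishes_to_order_sigma_fun])
  then show "vanishes_to_order (- 1) (- 1) 4 S_fun"
    by (simp add: S_fun_def[abs_def])
  show "vanishes_to_order (- 1) (- 1) 0 G_fun"
    by (intro vanishes_to_order_laurent_symbol laurent_symbol_G_fun) auto
  show "2 * m \<le> 4 * ((m + 1) div 2) + 0 * (m div 2)" by linarith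
qed

lemma vanishes_to_order_a_tilde_corner:
  assumes "(c, d) \<in> corners"
  shows "vanishes_to_order c d (2 * m) (a_tilde m)"
proof -
  have "(\<lambda>z w. a_tilde m w z) = a_tilde m"
    by (simp add: fun_eq_iff a_tilde_swap)
  then have "vanishes_to_order 1 (- 1) (2 * m) (a_tilde m)"
    using vanishes_to_order_swap[OF vanishes_to_order_a_tilde_neg_pos] by metis
  then show ?thesis
    using assms vanishes_to_order_a_tilde_neg_pos vanishes_to_order_a_tilde_neg_neg by auto
qed

lemma vanishes_to_order_a_family:
  assumes "(c, d) \<in> corners" "l < n"
  shows "vanishes_to_order c d (2 * n) (a_family n l)"
  unfolding a_family_def[abs_def]
proof (rule vanishes_to_order_sum)
  fix i assume "i \<in> {0..l}"
  have "vanishes_to_order c d (2 * (n - i) + 2 * i) (\<lambda>z w. a_tilde (n - i) z w * b_fun n i z w)"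
    using assms(1)
    by (intro vanishes_to_order_mult vanishes_to_order_a_tilde_corner vanishes_to_order_b_fun) auto
  then show "vanishes_to_order c d (2 * n) (\<lambda>z w. a_tilde (n - i) z w * b_fun n i z w)"
    using \<open>i \<in> {0..l}\<close> assms(2) by (simp add: algebra_simps)
qed

lemma generates_polys_a_family:
  assumes "l < n"
  shows "generates_polys (a_family n l) (2 * n - 1)"
  using assms by (intro generates_polysI) (simp add: vanishes_to_order_a_family)

lemma vanishes_to_order_a_family_minus_4:
  assumes "l \<le> m"
  shows "vanishes_to_order 1 1 (2 * Suc l) (\<lambda>z w. a_family (Suc m) l z w - 4)"
proof -
  let ?tail = "\<lambda>z w. \<Sum>i = Suc l..m. a_tilde (Suc m - i) z w * b_fun (Suc m) i z w"
  have "vanishes_to_order 1 1 (2 * Suc l) (\<lambda>z w. a_tilde (Suc m - i) z w * b_fun (Suc m) i z w)"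
    if "i \<in> {Suc l..m}" for i
  proof (rule vanishes_to_order_mono)
    show "vanishes_to_order 1 1 (0 + 2 * i) (\<lambda>z w. a_tilde (Suc m - i) z w * b_fun (Suc m) i z w)"
      by (intro vanishes_to_order_mult vanishes_to_order_b_fun vanishes_to_order_laurent_symbol
          laurent_symbol_a_tilde) auto
  qed (use that in simp)
  then have tail: "vanishes_to_order 1 1 (2 * Suc l) ?tail"
    by (rule vanishes_to_order_sum)
  have "vanishes_to_order 1 1 (2 * Suc m) (\<lambda>z w. a_family (Suc m) m z w - 4)"
    by (intro interpolatory_imp_vanishes_to_order interpolatory_a_family vanishes_to_order_a_family) auto
  then have full: "vanishes_to_order 1 1 (2 * Suc l) (\<lambda>z w. a_family (Suc m) m z w - 4)"
    by (rule vanishes_to_order_mono) (use assms in simp)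
  have "{0..m} = {0..l} \<union> {Suc l..m}" using assms by auto
  then have "a_family (Suc m) m z w = a_family (Suc m) l z w + ?tail z w" for z w
    by (simp add: a_family_def sum.union_disjoint)
  then show ?thesis using vanishes_to_order_diff[OF full tail] by simp
qed

lemma reproduces_polys_a_family:
  assumes "l < n"
  shows "reproduces_polys (a_family n l) (2 * l + 1)"
proof (rule reproduces_polysI)
  show "generates_polys (a_family n l) (2 * n - 1)"
    using assms by (rule generates_polys_a_family)
  show "2 * l + 1 \<le> 2 * n - 1" using assms by simp
  obtain m where "n = Suc m" using assms by (cases n) auto
  then show "vanishes_to_order 1 1 (Suc (2 * l + 1)) (\<lambda>z w. a_family n l z w - 4)"
    using vanishes_to_order_a_family_minus_4[of l m] assms by simp
qed

theorem theorem4p4: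
  shows "(\<forall>n l :: nat. 1 \<le> n \<and> l < n \<longrightarrow>
            laurent_symbol (a_family n l) \<and>
            symbol_symmetric (a_family n l) \<and>
            generates_polys (a_family n l) (2 * n - 1) \<and>
            reproduces_polys (a_family n l) (2 * l + 1)) \<and>
         (\<forall>n :: nat. 1 \<le> n \<longrightarrow> interpolatory (a_family n (n - 1)))"
proof (intro conjI allI impI)
  fix n :: nat assume "1 \<le> n"
  then show "interpolatory (a_family n (n - 1))"
    using interpolatory_a_family[of "n - 1"] by simp
qed (simp_all only: laurent_symbol_a_family symbol_symmetric_a_family
      generates_polys_a_family reproduces_polys_a_family)

end
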